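(* Let $n\ge 1$, let $\boldsymbol{W}\in\mathbb{R}^{n\times n}$ be a symmetric matrix with nonnegative entries and strictly positive row sums, let $\boldsymbol{D}$ be the diagonal matrix with $\boldsymbol{D}_{ii}=\sum_{j=1}^n \boldsymbol{W}_{ij}$, let $\boldsymbol{E}\in\mathbb{R}^{n\times n}$ be positive semidefinite, and let $\mu>0$. Consider the unconstrained problem of minimizing over $\boldsymbol{F}\in\mathbb{R}^{n\times n}$ $$J(\boldsymbol{F})=\frac14\sum_{k=1}^{n}\sum_{i,j=1}^{n}\left[\boldsymbol{W}_{ij}\Big(\frac{\boldsymbol{F}_{ki}}{\sqrt{\boldsymbol{D}_{ii}}}-\frac{\boldsymbol{F}_{kj}}{\sqrt{\boldsymbol{D}_{jj}}}\Big)^2+\boldsymbol{W}_{ij}\Big(\frac{\boldsymbol{F}_{ik}}{\sqrt{\boldsymbol{D}_{ii}}}-\frac{\boldsymbol{F}_{jk}}{\sqrt{\boldsymbol{D}_{jj}}}\Big)^2\right]+\mu\Vert\boldsymbol{F}-\boldsymbol{E}\Vert_F^2 .$$ Put $\alpha=\frac{1}{1+\mu}$, $\boldsymbol{S}=\boldsymbol{D}^{-1/2}\boldsymbol{W}\boldsymbol{D}^{-1/2}$ and $\bar{\mathbb{S}}=\frac12(\boldsymbol{S}\otimes\boldsymbol{I}+\boldsymbol{I}\otimes\boldsymbol{S})\in\mathbb{R}^{n^2\times n^2}$. Then the optimal solution (minimizer) is $$\boldsymbol{F}^*=(1-\alpha)\,\mathrm{vec}^{-1}\big((\mathbb{I}-\alpha\bar{\mathbb{S}})^{-1}\mathrm{vec}(\boldsymbol{E})\big),$$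 and, equivalently, $\boldsymbol{F}^*$ is the solution of the Lyapunov equation $$(\boldsymbol{I}-\alpha\boldsymbol{S})\boldsymbol{F}+\boldsymbol{F}(\boldsymbol{I}-\alpha\boldsymbol{S})=2(1-\alpha)\boldsymbol{E}.$$
   Context: $\boldsymbol{I}$ is the $n\times n$ identity matrix and $\mathbb{I}$ the $n^2\times n^2$ identity matrix. $\otimes$ is the Kronecker product. $\mathrm{vec}:\mathbb{R}^{n\times n}\to\mathbb{R}^{n^2}$ stacks the columns of a matrix into one column vector, and $\mathrm{vec}^{-1}$ is its inverse. $\Vert\cdot\Vert_F$ is the Frobenius norm. *)

theory Defs
  imports "HOL-Analysis.Analysis"
begin

definition positive_semidefinite :: "real^'n^'n \<Rightarrow> bool" where
  "positive_semidefinite A \<longleftrightarrow> transpose A = A \<and> (\<forall>x. 0 \<le> x \<bullet> (A *v x))"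

definition degree_matrix :: "real^'n^'n \<Rightarrow> real^'n^'n" where
  "degree_matrix W = (\<chi> i j. if i = j then (\<Sum>k\<in>UNIV. W $ i $ k) else 0)"

(* Power -1/2 of a diagonal matrix with positive diagonal; off-diagonal entries of the
   argument are ignored. *)
definition diag_inv_sqrt :: "real^'n^'n \<Rightarrow> real^'n^'n" where
  "diag_inv_sqrt D = (\<chi> i j. if i = j then 1 / sqrt (D $ i $ i) else 0)"

lemma diag_inv_sqrt_degree_matrix:
  assumes "\<And>i. 0 < (\<Sum>k\<in>UNIV. W $ i $ k)"
  shows "(diag_inv_sqrt (degree_matrix W) ** diag_inv_sqrt (degree_matrix W)) **
    degree_matrix W = mat 1"
proof -
  let ?d = "\<lambda>i. \<Sum>k\<in>UNIV. W $ i $ k"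
  have "sqrt (?d i) * sqrt (?d i) = ?d i" "?d i \<noteq> 0" for i
    using assms[of i] by (auto simp: less_imp_le)
  then show ?thesis
    by (auto simp: vec_eq_iff matrix_matrix_mult_def diag_inv_sqrt_def degree_matrix_def mat_def
        if_distrib[of "\<lambda>x. x * _"] if_distrib[of "\<lambda>x. _ * x"] sum.delta cong: if_cong)
qed

(* R^(n^2) and the n^2 x n^2 matrices are indexed by the pairs in 'n * 'n, ordered
   lexicographically: (p, r) stands for position (p - 1) n + r.  Column j of a matrix therefore
   occupies the block of positions (j, _) of its vectorization. *)
definition kronecker_product :: "real^'n^'n \<Rightarrow> real^'n^'n \<Rightarrow> real^('n \<times> 'n)^('n \<times> 'n)"
    (infixl "\<otimes>\<^sub>K" 70) where
  "A \<otimes>\<^sub>K B = (\<chi> p q. A $ fst p $ fst q * B $ snd p $ snd q)"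

definition vectorize :: "real^'n^'n \<Rightarrow> real^('n \<times> 'n)" where
  "vectorize A = (\<chi> p. column (fst p) A $ snd p)"

lemma bij_vectorize: "bij (vectorize :: real^'n^'n \<Rightarrow> _)"
proof (rule bijI')
  show "vectorize A = vectorize B \<longleftrightarrow> A = B" for A B :: "real^'n^'n"
    by (auto simp: vectorize_def column_def vec_eq_iff)
  show "\<exists>A. v = vectorize A" for v :: "real^('n::finite \<times> 'n)"
    by (rule exI[of _ "\<chi> i j. v $ (j, i)"]) (simp add: vectorize_def column_def vec_eq_iff)
qed

(* The norm of the type real^'n^'n is the Frobenius norm. *)
lemma norm_eq_Frobenius:
  fixes A :: "real^'n^'n"
  shows "norm A = sqrt (\<Sum>i\<in>UNIV. \<Sum>j\<in>UNIV. (A $ i $ j)\<^sup>2)"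
  by (simp add: norm_vec_def L2_set_def sum_nonneg)

definition objective ::
    "real^'n^'n \<Rightarrow> real^'n^'n \<Rightarrow> real^'n^'n \<Rightarrow> real \<Rightarrow> real^'n^'n \<Rightarrow> real" where
  "objective W D E \<mu> F =
     1/4 * (\<Sum>k\<in>UNIV. \<Sum>i\<in>UNIV. \<Sum>j\<in>UNIV.
        W $ i $ j * (F $ k $ i / sqrt (D $ i $ i) - F $ k $ j / sqrt (D $ j $ j))\<^sup>2
      + W $ i $ j * (F $ i $ k / sqrt (D $ i $ i) - F $ j $ k / sqrt (D $ j $ j))\<^sup>2)
     + \<mu> * (norm (F - E))\<^sup>2"

end

(* With L F = (S F + F S) / 2 the objective is F . (F - L F) + \<mu> |F - E|^2 for the Frobenius
   inner product, i.e. (1 + \<mu>) F . A F - 2 \<mu> F . E + \<mu> E . E with A F = F - \<alpha> L F.  The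
   smoothness part is a sum of nonnegative terms, so (1 + \<mu>) F . A F \<ge> \<mu> |F|^2: the self-adjoint
   operator A is positive definite, and completing the square shows that the unique minimizer solves
   A F = (1 - \<alpha>) E.  Twice this equation is the Lyapunov equation, and vectorization turns A into
   the matrix I - \<alpha> SS. *)
theory Submission
  imports Defs
begin

text \<open>When the square is expanded, each squared term carries the weights of a full row or, by
  symmetry, a full column of \<open>W\<close>, which add up to \<open>d\<close> and cancel the
  normalization; the mixed terms are the quadratic form of \<open>S\<close>.\<close>

lemma normalized_smoothness:
  fixes W :: "real^'n^'n" and x :: "real^'n"
  assumes W_sym: "transpose W = W"
    and W_rows: "\<And>i. 0 < (\<Sum>j\<in>UNIV. W $ i $ j)"
    and d: "\<And>i. d i = (\<Sum>j\<in>UNIV. W $ i $ j)"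
    and S: "\<And>i j. S $ i $ j = W $ i $ j / (sqrt (d i) * sqrt (d j))"
  shows "(\<Sum>i\<in>UNIV. \<Sum>j\<in>UNIV. W $ i $ j * (x $ i / sqrt (d i) - x $ j / sqrt (d j))\<^sup>2)
    = 2 * (x \<bullet> x) - 2 * (x \<bullet> (S *v x))"
proof -
  have sym: "W $ i $ j = W $ j $ i" for i j
    using W_sym by (metis transpose_def vec_lambda_beta)
  have pos: "0 < d i" for i
    using W_rows d by simp
  \<comment> \<open>Symmetry puts \<open>W $ j $ i\<close> in the second term, so that exchanging
    the two sums turns it into the first.\<close>
  have expand: "W $ i $ j * (x $ i / sqrt (d i) - x $ j / sqrt (d j))\<^sup>2
      = W $ i $ j * ((x $ i)\<^sup>2 / d i) + W $ j $ i * ((x $ j)\<^sup>2 / d j)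
        - 2 * (x $ i * (S $ i $ j * x $ j))" for i j
    using pos[of i] pos[of j] sym[of j i]
    by (simp add: S power2_diff power_divide field_simps)
  have diag: "(\<Sum>i\<in>UNIV. \<Sum>j\<in>UNIV. W $ i $ j * ((x $ i)\<^sup>2 / d i)) = x \<bullet> x"
  proof -
    have "(\<Sum>j\<in>UNIV. W $ i $ j * ((x $ i)\<^sup>2 / d i)) = x $ i * x $ i" for i
      unfolding sum_distrib_right[symmetric] d[symmetric]
      using pos[of i] by (simp add: power2_eq_square)
    then show ?thesis by (simp add: inner_vec_def)
  qed
  have "(\<Sum>i\<in>UNIV. \<Sum>j\<in>UNIV. W $ j $ i * ((x $ j)\<^sup>2 / d j)) = x \<bullet> x"
    by (subst sum.swap) (rule diag)
  moreover have "(\<Sum>i\<in>UNIV. \<Sum>j\<in>UNIV. 2 * (x $ i * (S $ i $ j * x $ j))) = 2 * (x \<bullet> (S *v x))"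
    by (simp add: inner_vec_def matrix_vector_mult_def sum_distrib_left)
  ultimately show ?thesis
    using diag by (simp add: expand sum.distrib sum_subtractf)
qed

text \<open>Left multiplication acts on each column separately, so vector identities such as
  \<open>normalized_smoothness\<close> can be summed over the columns.\<close>

lemma inner_matrix_mult_columns:
  fixes F :: "real^'m^'n" and S :: "real^'n^'n"
  shows "F \<bullet> (S ** F) = (\<Sum>k\<in>UNIV. column k F \<bullet> (S *v column k F))"
  unfolding inner_vec_def matrix_matrix_mult_def matrix_vector_mult_def column_def
  by simp (rule sum.swap)

lemma inner_transpose:
  fixes A B :: "real^'n^'m"
  shows "transpose A \<bullet> transpose B = A \<bullet> B"
  unfolding inner_vec_def transpose_def by simp (rule sum.swap)

lemma inner_mult_symmetric_left:
  fixes F G :: "real^'m^'n" and S :: "real^'n^'n"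
  assumes "transpose S = S"
  shows "F \<bullet> (S ** G) = (S ** F) \<bullet> G"
proof -
  have sym: "S $ i $ j = S $ j $ i" for i j
    using assms by (metis transpose_def vec_lambda_beta)
  have "F \<bullet> (S ** G) = (\<Sum>i\<in>UNIV. \<Sum>k\<in>UNIV. \<Sum>j\<in>UNIV. F $ i $ k * (S $ i $ j * G $ j $ k))"
    by (simp add: inner_vec_def matrix_matrix_mult_def sum_distrib_left)
  also have "\<dots> = (\<Sum>i\<in>UNIV. \<Sum>j\<in>UNIV. \<Sum>k\<in>UNIV. F $ i $ k * (S $ i $ j * G $ j $ k))"
    by (intro sum.cong refl sum.swap)
  also have "\<dots> = (\<Sum>j\<in>UNIV. \<Sum>i\<in>UNIV. \<Sum>k\<in>UNIV. F $ i $ k * (S $ i $ j * G $ j $ k))"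
    by (rule sum.swap)
  also have "\<dots> = (\<Sum>j\<in>UNIV. \<Sum>k\<in>UNIV. \<Sum>i\<in>UNIV. F $ i $ k * (S $ i $ j * G $ j $ k))"
    by (intro sum.cong refl sum.swap)
  also have "\<dots> = (S ** F) \<bullet> G"
    by (simp add: inner_vec_def matrix_matrix_mult_def sum_distrib_left sum_distrib_right
        sym[of _ "_ :: 'n"] mult_ac)
  finally show ?thesis .
qed

lemma inner_mult_symmetric_right:
  fixes F G :: "real^'n^'m" and S :: "real^'n^'n"
  assumes "transpose S = S"
  shows "F \<bullet> (G ** S) = (F ** S) \<bullet> G"
  using inner_mult_symmetric_left[OF assms, of "transpose F" "transpose G"]
  by (metis assms inner_transpose matrix_transpose_mul)

text \<open>The second family of squares in the objective runs over the columns of \<open>F\<close>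
  and yields \<open>S ** F\<close>; the first runs over the rows, that is, the columns of
  \<open>transpose F\<close>, and yields \<open>F ** S\<close>. Each family contributes
  \<open>2 * (F \<bullet> F)\<close>, which the factor 1/4 normalizes.\<close>

lemma objective_eq:
  fixes W D E F S :: "real^'n^'n"
  assumes W_sym: "transpose W = W"
    and W_rows: "\<And>i. 0 < (\<Sum>j\<in>UNIV. W $ i $ j)"
    and D: "D = degree_matrix W"
    and S: "\<And>i j. S $ i $ j = W $ i $ j / (sqrt (D $ i $ i) * sqrt (D $ j $ j))"
  shows "objective W D E \<mu> F
    = F \<bullet> F - F \<bullet> ((1/2) *\<^sub>R (S ** F + F ** S)) + \<mu> * (norm (F - E))\<^sup>2"
proof -
  have d: "D $ i $ i = (\<Sum>j\<in>UNIV. W $ i $ j)" for i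
    by (simp add: D degree_matrix_def)
  note smooth = normalized_smoothness[OF W_sym W_rows d S]
  have S_sym: "transpose S = S"
    using W_sym by (simp add: vec_eq_iff transpose_def S mult.commute)
  have cols: "(\<Sum>k\<in>UNIV. \<Sum>i\<in>UNIV. \<Sum>j\<in>UNIV.
      W $ i $ j * (G $ i $ k / sqrt (D $ i $ i) - G $ j $ k / sqrt (D $ j $ j))\<^sup>2)
      = 2 * (G \<bullet> G) - 2 * (G \<bullet> (S ** G))" for G :: "real^'n^'n"
  proof -
    have "(\<Sum>k\<in>UNIV. column k G \<bullet> column k G) = G \<bullet> G"
      using inner_matrix_mult_columns[of G "mat 1"] by simp
    then show ?thesis
      using smooth[of "column _ G"]
      by (simp add: column_def sum_subtractf inner_matrix_mult_columns flip: sum_distrib_left)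
  qed
  have "transpose F \<bullet> (S ** transpose F) = F \<bullet> (F ** S)"
    by (metis S_sym inner_transpose matrix_transpose_mul)
  then have rows: "(\<Sum>k\<in>UNIV. \<Sum>i\<in>UNIV. \<Sum>j\<in>UNIV.
      W $ i $ j * (F $ k $ i / sqrt (D $ i $ i) - F $ k $ j / sqrt (D $ j $ j))\<^sup>2)
      = 2 * (F \<bullet> F) - 2 * (F \<bullet> (F ** S))"
    using cols[of "transpose F"] by (simp add: inner_transpose) (simp add: transpose_def)
  show ?thesis
    unfolding objective_def sum.distrib rows cols
    by (simp add: inner_add_right algebra_simps)
qed

lemma vectorize_scaleR: "vectorize (c *\<^sub>R A) = c *\<^sub>R vectorize A"
  by (simp add: vectorize_def column_def vec_eq_iff)

lemma vectorize_add: "vectorize (A + B) = vectorize A + vectorize B"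
  by (simp add: vectorize_def column_def vec_eq_iff)

lemma vectorize_diff: "vectorize (A - B) = vectorize A - vectorize B"
  by (simp add: vectorize_def column_def vec_eq_iff)

text \<open>The first component of a pair is the column index, so the left Kronecker factor mixes
  columns and appears transposed on the right of \<open>F\<close>. Setting one factor to
  \<open>mat 1\<close> handles each summand of \<open>SS\<close>.\<close>

lemma vectorize_sandwich: "(B \<otimes>\<^sub>K A) *v vectorize F = vectorize (A ** F ** transpose B)"
proof -
  have "(\<Sum>q\<in>UNIV. B $ j $ fst q * A $ i $ snd q * F $ snd q $ fst q)
      = (\<Sum>l\<in>UNIV. (\<Sum>k\<in>UNIV. A $ i $ k * F $ k $ l) * B $ j $ l)" for i j
    by (simp add: sum.cartesian_product' sum_distrib_left sum_distrib_right mult_ac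
        flip: UNIV_Times_UNIV)
  then show ?thesis
    by (simp add: vec_eq_iff matrix_vector_mult_def matrix_matrix_mult_def vectorize_def
        column_def kronecker_product_def transpose_def)
qed

lemma matrix_diff_ldistrib: "(A :: real^'n^'m) ** (B - C) = A ** B - A ** C"
  by (simp add: vec_eq_iff matrix_matrix_mult_def right_diff_distrib sum_subtractf)

lemma matrix_diff_rdistrib: "(A - B) ** (C :: real^'n^'m) = A ** C - B ** C"
  by (simp add: vec_eq_iff matrix_matrix_mult_def left_diff_distrib sum_subtractf)

theorem mainTheorem1:
  fixes W D E S F_star :: "real^'n^'n"
    and SS :: "real^('n \<times> 'n)^('n \<times> 'n)"
    and \<mu> \<alpha> :: real
  assumes W_sym: "transpose W = W"
    and W_nonneg: "\<And>i j. 0 \<le> W $ i $ j"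
    and W_rows: "\<And>i. 0 < (\<Sum>j\<in>UNIV. W $ i $ j)"
    and D: "D = degree_matrix W"
    and E: "positive_semidefinite E"
    and \<mu>: "0 < \<mu>"
    and \<alpha>: "\<alpha> = 1 / (1 + \<mu>)"
    and S: "S = diag_inv_sqrt D ** W ** diag_inv_sqrt D"
    and SS: "SS = (1/2) *\<^sub>R (S \<otimes>\<^sub>K mat 1 + mat 1 \<otimes>\<^sub>K S)"
    and F_star: "F_star =
      (1 - \<alpha>) *\<^sub>R inv vectorize (matrix_inv (mat 1 - \<alpha> *\<^sub>R SS) *v vectorize E)"
  shows "invertible (mat 1 - \<alpha> *\<^sub>R SS)
    \<and> (\<forall>F. is_arg_min (objective W D E \<mu>) (\<lambda>_. True) F \<longleftrightarrow> F = F_star)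
    \<and> (\<forall>F. (mat 1 - \<alpha> *\<^sub>R S) ** F + F ** (mat 1 - \<alpha> *\<^sub>R S) = (2 * (1 - \<alpha>)) *\<^sub>R E
          \<longleftrightarrow> F = F_star)"
proof -
  define L :: "real^'n^'n \<Rightarrow> real^'n^'n" where "L F = (1/2) *\<^sub>R (S ** F + F ** S)" for F
  define A :: "real^'n^'n \<Rightarrow> real^'n^'n" where "A F = F - \<alpha> *\<^sub>R L F" for F
  let ?M = "mat 1 - \<alpha> *\<^sub>R SS"
  let ?J = "objective W D E \<mu>"
  \<comment> \<open>Scaling by \<open>1 + \<mu>\<close> removes \<alpha> from the quadratic form of
    \<open>A\<close> and turns \<open>(1 - \<alpha>) *\<^sub>R E\<close> into
    \<open>\<mu> *\<^sub>R E\<close>.\<close>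
  have \<alpha>_mult: "(1 + \<mu>) * \<alpha> = 1" "(1 + \<mu>) * (1 - \<alpha>) = \<mu>"
    using \<mu> by (auto simp: \<alpha> field_simps)
  have S_entry: "S $ i $ j = W $ i $ j / (sqrt (D $ i $ i) * sqrt (D $ j $ j))" for i j
    by (simp add: S diag_inv_sqrt_def matrix_matrix_mult_def if_distrib[of "\<lambda>x. x * _"]
        if_distrib[of "\<lambda>x. _ * x"] sum.delta sum.delta' cong: if_cong)
  have S_sym: "transpose S = S"
    using W_sym by (simp add: vec_eq_iff transpose_def S_entry mult.commute)
  have A_diff: "A (F - G) = A F - A G" for F G
    by (simp add: A_def L_def matrix_diff_ldistrib matrix_diff_rdistrib algebra_simps)
  have A_sym: "F \<bullet> A G = G \<bullet> A F" for F G
    using inner_mult_symmetric_left[OF S_sym, of F G] inner_mult_symmetric_right[OF S_sym, of F G]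
    by (simp add: A_def L_def inner_diff_right inner_add_right inner_commute)
  have J: "?J F = (1 + \<mu>) * (F \<bullet> A F) - 2 * \<mu> * (F \<bullet> E) + \<mu> * (E \<bullet> E)" for F
  proof -
    have "(1 + \<mu>) * (F \<bullet> A F) = (1 + \<mu>) * (F \<bullet> F) - ((1 + \<mu>) * \<alpha>) * (F \<bullet> L F)"
      by (simp add: A_def inner_diff_right algebra_simps)
    then have "(1 + \<mu>) * (F \<bullet> A F) = (1 + \<mu>) * (F \<bullet> F) - F \<bullet> L F"
      by (simp only: \<alpha>_mult mult_1)
    moreover have "(norm (F - E))\<^sup>2 = F \<bullet> F - 2 * (F \<bullet> E) + E \<bullet> E"
      by (simp add: power2_norm_eq_inner inner_diff_left inner_diff_right inner_commute)
    ultimately show ?thesis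
      using objective_eq[OF W_sym W_rows D S_entry, of E \<mu> F, folded L_def]
      by (simp add: distrib_left distrib_right right_diff_distrib)
  qed
  have coercive: "\<mu> * (F \<bullet> F) \<le> (1 + \<mu>) * (F \<bullet> A F)" for F
  proof -
    \<comment> \<open>The smoothness part is nonnegative. Once both sides are expanded, all terms
      containing \<open>E\<close> cancel and the bound on the quadratic form remains.\<close>
    have "\<mu> * (norm (F - E))\<^sup>2 \<le> ?J F"
      unfolding objective_def using W_nonneg by (simp add: sum_nonneg)
    then show ?thesis
      by (simp add: J power2_norm_eq_inner inner_diff_left inner_diff_right inner_commute
          algebra_simps)
  qed
  \<comment> \<open>If \<open>A (F - G)\<close> vanishes, coercivity gives
    \<open>\<mu> * (norm (F - G))\<^sup>2 \<le> 0\<close>.\<close>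
  have A_inj: "F = G" if "A F = A G" for F G
    using coercive[of "F - G"] that \<mu> by (simp add: A_diff mult_le_0_iff flip: power2_norm_eq_inner)
  have M_vec: "?M *v vectorize F = vectorize (A F)" for F
    by (simp add: A_def L_def SS matrix_vector_mult_diff_rdistrib matrix_vector_mult_add_rdistrib
        scaleR_matrix_vector_assoc[symmetric] vectorize_sandwich vectorize_diff vectorize_add vectorize_scaleR
        S_sym transpose_mat add.commute)
  have vec_inj: "inj (vectorize :: real^'n^'n \<Rightarrow> _)" and vec_surj: "surj (vectorize :: real^'n^'n \<Rightarrow> _)"
    using bij_vectorize by (auto simp: bij_def)
  \<comment> \<open>Every vector is some \<open>vectorize F\<close>, so injectivity passes from
    \<open>A\<close> to \<open>?M\<close>; for a square matrix this is invertibility.\<close>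
  have "inj ((*v) ?M)"
  proof (rule injI)
    fix x y assume eq: "?M *v x = ?M *v y"
    obtain F G where "x = vectorize F" "y = vectorize G"
      using vec_surj by (metis surjD)
    with eq show "x = y"
      using A_inj vec_inj by (simp add: M_vec inj_eq)
  qed
  then have inv: "invertible ?M"
    by (simp add: invertible_left_inverse matrix_left_invertible_injective)
  \<comment> \<open>\<open>matrix_inv\<close> is defined by choice; invertibility supplies the
    witness that makes it an actual inverse.\<close>
  have matrix_mult_inv: "?M ** matrix_inv ?M = mat 1"
    using someI_ex[OF inv[unfolded invertible_def]] by (simp add: matrix_inv_def)
  have "vectorize (A F_star) = (1 - \<alpha>) *\<^sub>R (?M *v (matrix_inv ?M *v vectorize E))"
    by (simp only: M_vec[symmetric] F_star vectorize_scaleR surj_f_inv_f[OF vec_surj]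
        matrix_vector_mult_scaleR)
  also have "\<dots> = vectorize ((1 - \<alpha>) *\<^sub>R E)"
    by (simp add: matrix_vector_mul_assoc matrix_mult_inv vectorize_scaleR)
  finally have A_star: "A F_star = (1 - \<alpha>) *\<^sub>R E"
    using vec_inj by (simp add: inj_eq)
  have J_star: "?J F = ?J F_star + (1 + \<mu>) * ((F - F_star) \<bullet> A (F - F_star))" for F
  proof -
    have "(F - F_star) \<bullet> A (F - F_star) = F \<bullet> A F - 2 * (F \<bullet> A F_star) + F_star \<bullet> A F_star"
      using A_sym[of F_star F] by (simp add: A_diff inner_diff_left inner_diff_right)
    \<comment> \<open>Taken at \<open>G = F\<close> this cancels the terms linear in
      \<open>F\<close>; taken at \<open>G = F_star\<close> it matches the constants.\<close>
    moreover have "(1 + \<mu>) * (G \<bullet> A F_star) = \<mu> * (G \<bullet> E)" for G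
      by (simp add: A_star \<alpha>_mult flip: mult.assoc)
    ultimately show ?thesis
      by (simp add: J right_diff_distrib distrib_left mult.left_commute[of "1 + \<mu>" 2])
  qed
  \<comment> \<open>This quadratic growth around \<open>F_star\<close> gives both minimality and
    uniqueness.\<close>
  have min: "?J F_star + \<mu> * (norm (F - F_star))\<^sup>2 \<le> ?J F" for F
    using J_star[of F] coercive[of "F - F_star"] by (simp add: power2_norm_eq_inner)
  have "is_arg_min ?J (\<lambda>_. True) F \<longleftrightarrow> F = F_star" for F
  proof
    assume "is_arg_min ?J (\<lambda>_. True) F"
    then have "?J F \<le> ?J F_star"
      by (simp add: is_arg_min_linorder)
    then have "\<mu> * (norm (F - F_star))\<^sup>2 \<le> 0"
      using min[of F] by simp
    then show "F = F_star"
      using \<mu> by (simp add: mult_le_0_iff)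
  next
    have "?J F_star \<le> ?J G" for G
      by (rule order_trans[OF _ min]) (use \<mu> in simp)
    then show "is_arg_min ?J (\<lambda>_. True) F" if "F = F_star"
      using that by (simp add: is_arg_min_linorder)
  qed
  moreover have "(mat 1 - \<alpha> *\<^sub>R S) ** F + F ** (mat 1 - \<alpha> *\<^sub>R S) = (2 * (1 - \<alpha>)) *\<^sub>R E
      \<longleftrightarrow> F = F_star" for F
  proof -
    have "(mat 1 - \<alpha> *\<^sub>R S) ** F + F ** (mat 1 - \<alpha> *\<^sub>R S) = 2 *\<^sub>R A F"
      by (simp add: A_def L_def matrix_diff_ldistrib matrix_diff_rdistrib scaleR_2 algebra_simps
          scalar_matrix_assoc matrix_scalar_ac)
    \<comment> \<open>By \<open>A_star\<close> the right-hand side is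
      \<open>2 *\<^sub>R A F_star\<close>, so injectivity of \<open>A\<close> identifies the
      solution.\<close>
    then have "(mat 1 - \<alpha> *\<^sub>R S) ** F + F ** (mat 1 - \<alpha> *\<^sub>R S) = (2 * (1 - \<alpha>)) *\<^sub>R E
        \<longleftrightarrow> 2 *\<^sub>R A F = 2 *\<^sub>R A F_star"
      by (simp add: A_star)
    also have "\<dots> \<longleftrightarrow> F = F_star"
      using A_inj by auto
    finally show ?thesis .
  qed
  ultimately show ?thesis
    using inv by blast
qed

end
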